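(* Let $d,m\in\mathbf N$, let $\xi$ be a random vector in $\mathbf R^d$ with distribution $F=\mathcal L(\xi)\in\mathfrak F_d$, and let $t_1,\ldots,t_m\in\mathbf R^d$. Assume that for each $j=1,\ldots,m$ the distribution of the random variable $\langle\xi,t_j\rangle$ is either non-degenerate or equal to $E\in\mathfrak F_1$ (the distribution concentrated at $0$). Then there exists a constant $c(F,t_1,\ldots,t_m)>0$ depending only on $F,t_1,\ldots,t_m$ such that, for all $n\in\mathbf N$ and all $X\in\mathfrak X(t_1,\ldots,t_m)$, $$\big|(F^n)\{X\}-(F^{n+1})\{X\}\big|\le c(F,t_1,\ldots,t_m)\,n^{-1/2}.$$
   Context: $\mathbf N=\{1,2,\ldots\}$. $\mathfrak F_d$ is the set of Borel probability distributions on $\mathbf R^d$. Powers of measures are understood in the sense of convolution: $F^n=F^{n*}$ is the $n$-fold convolution of $F$ with itself. For $t_1,\ldots,t_m\in\mathbf R^d$, $\mathfrak X(t_1,\ldots,t_m)$ denotes the collection of convex polyhedra $X\subset\mathbf R^d$ representable in the form $$X=\big\{x\in\mathbf R^d: a_j\le\langle x,t_j\rangle\le b_j,\ j=1,\ldots,m\big\}$$ with $-\infty\le a_j\le b_j\le\infty$, $j=1,\ldots,m$. A distribution on $\mathbf R$ is degenerate if it is concentrated at a single point, and non-degenerate otherwise. *)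

theory Defs
  imports "HOL-Probability.Probability"
begin

primrec conv_power :: "'a :: ordered_euclidean_space measure \<Rightarrow> nat \<Rightarrow> 'a measure" where
  "conv_power F 0 = return borel 0"
| "conv_power F (Suc n) = convolution F (conv_power F n)"

lemma conv_power_1:
  assumes "prob_space F" and sets_F: "sets F = sets borel"
  shows "conv_power F 1 = F"
proof -
  interpret F: prob_space F by fact
  have fin: "finite_measure (return borel (0::'a))"
    by (intro prob_space.finite_measure prob_space_return) simp
  show ?thesis
  proof (rule measure_eqI)
    show "sets (conv_power F 1) = sets F" by (simp add: sets_F)
    fix A assume "A \<in> sets (conv_power F 1)"
    then have [measurable]: "A \<in> sets borel" by simp
    have "emeasure (convolution F (return borel 0)) A
        = (\<integral>\<^sup>+x. \<integral>\<^sup>+y. indicator A (x + y) \<partial>return borel 0 \<partial>F)"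
      by (rule convolution_emeasure') (use fin F.finite_measure_axioms sets_F in auto)
    also have "\<dots> = (\<integral>\<^sup>+x. indicator A x \<partial>F)"
      by (intro nn_integral_cong, subst nn_integral_return) auto
    also have "\<dots> = emeasure F A" by (simp add: sets_F)
    finally show "emeasure (conv_power F 1) A = emeasure F A" by simp
  qed
qed

definition degenerate :: "real measure \<Rightarrow> bool" where
  "degenerate G \<longleftrightarrow> (\<exists>a. AE x in G. x = a)"

text \<open>If a random vector has law \<open>F\<close>, then \<open>projection_law F t\<close> is the law of its inner
  product with \<open>t\<close>; see the lemma below.\<close>

definition projection_law :: "'a :: euclidean_space measure \<Rightarrow> 'a \<Rightarrow> real measure" where
  "projection_law F t = distr F borel (\<lambda>x. x \<bullet> t)"

lemma projection_law_distr:
  assumes "\<xi> \<in> borel_measurable M"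
  shows "projection_law (distr M borel \<xi>) t = distr M borel (\<lambda>\<omega>. \<xi> \<omega> \<bullet> t)"
  using assms by (simp add: projection_law_def distr_distr o_def)

text \<open>The bounds are extended reals, so that each individual constraint may be absent.
  Only the values of \<open>t\<close>, \<open>a\<close>, \<open>b\<close> on \<open>{1..m}\<close> matter.\<close>

definition polyhedra :: "nat \<Rightarrow> (nat \<Rightarrow> 'a :: euclidean_space) \<Rightarrow> 'a set set" where
  "polyhedra m t = {X. \<exists>a b :: nat \<Rightarrow> ereal. (\<forall>j\<in>{1..m}. a j \<le> b j) \<and>
     X = {x. \<forall>j\<in>{1..m}. a j \<le> ereal (x \<bullet> t j) \<and> ereal (x \<bullet> t j) \<le> b j}}"

end

theory Submission
  imports Defs
begin

text \<open>
  Write \<open>\<mu>\<^sub>n\<close> for the \<open>n\<close>-fold convolution power of \<open>F\<close>, let \<open>S\<close> be distributed according to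
  \<open>\<mu>\<^sub>n\<close> and let \<open>\<xi>\<close> be an independent step with law \<open>F\<close>. Then \<open>\<bar>\<mu>\<^sub>n(X) - \<mu>\<^sub>n\<^sub>+\<^sub>1(X)\<bar>\<close> is at most the
  probability that exactly one of \<open>S\<close>, \<open>S + \<xi>\<close> lies in \<open>X\<close>. A polyhedron is an intersection of at
  most \<open>2m\<close> half-spaces with normals \<open>t\<^sub>j\<close> and \<open>- t\<^sub>j\<close>, so it is enough to bound the probability
  that the last step crosses the boundary of one half-space \<open>{x. \<langle>x, t\<rangle> \<le> b}\<close>, uniformly in \<open>b\<close>. If
  \<open>\<langle>\<xi>, t\<rangle> = 0\<close> almost surely, no crossing ever happens. Otherwise \<open>\<langle>\<xi>, t\<rangle>\<close> is non-degenerate, but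
  no moments are available.

  The core is a bound for the resampling influence. Put
  \<open>p(s) = P(\<langle>s + \<xi>, t\<rangle> > b)\<close>; then \<open>p(1 - p)\<close> integrated against \<open>\<mu>\<^sub>k\<close> is the probability that
  replacing the last of \<open>k + 1\<close> steps by an independent copy carries the sum from above \<open>b\<close> to at most
  \<open>b\<close>. This is at most \<open>1 / sqrt (k + 1)\<close> for every \<open>F\<close> (lemma \<open>integral_tail_variance_le\<close>). Indeed, let
  \<open>g(x) = E sgn(\<langle>x - \<xi>, t\<rangle>)\<close>. By antisymmetry \<open>E g(\<xi>) = 0\<close>, and the covariance of \<open>g(\<xi>)\<close> with the
  indicator of \<open>\<langle>s + \<xi>, t\<rangle> > b\<close> is \<open>p(s)(1 - p(s))\<close>. Hence, for independent steps
  \<open>\<xi>\<^sub>0, \<dots>, \<xi>\<^sub>k\<close>, the integral times \<open>k + 1\<close> equals the expectation of \<open>\<Sum>\<^sub>i g(\<xi>\<^sub>i)\<close> over the event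
  that the sum exceeds \<open>b\<close>, and this is at most the standard deviation of \<open>\<Sum>\<^sub>i g(\<xi>\<^sub>i)\<close>, which is at
  most \<open>sqrt (k + 1)\<close>.

  The influence bound is used twice. First, non-degeneracy provides levels \<open>u < w\<close> such that
  \<open>\<langle>\<xi>, t\<rangle> \<le> u\<close> and \<open>\<langle>\<xi>, t\<rangle> \<ge> w\<close> both have positive probability, so a sum lying in a window of length
  \<open>(w - u) / 3\<close> leaves it with probability bounded below, in a known direction, when its last step is
  resampled. This gives the concentration bound \<open>O(1 / sqrt n)\<close> for windows of any fixed length (lemma
  \<open>conv_power_concentration\<close>). Second, choose \<open>L\<close> such that \<open>\<bar>\<langle>\<xi>, t\<rangle>\<bar> \<le> L\<close> has probability at least
  one half. When \<open>\<langle>s, t\<rangle>\<close> is within \<open>L\<close> of \<open>b\<close>, concentration applies; otherwise a typical step does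
  not cross, so the crossing probability, which is \<open>p(s)\<close> or \<open>1 - p(s)\<close>, is at most one half and
  therefore at most \<open>2 p(s)(1 - p(s))\<close> (lemma \<open>crossing_halfspace_le\<close>).
\<close>

section \<open>Convolution powers as laws of sums of independent vectors\<close>

text \<open>Borel probability measures on a Euclidean space.\<close>

locale borel_prob_space = prob_space F
  for F :: "'a :: ordered_euclidean_space measure" +
  assumes sets_F [measurable_cong, simp]: "sets F = sets borel"
begin

lemma space_F [simp]: "space F = UNIV"
  using sets_eq_imp_space_eq[OF sets_F] by simp

lemma prob_UNIV [simp]: "measure F UNIV = 1"
  using prob_space by simp

lemma sets_conv_power [measurable_cong, simp]: "sets (conv_power F n) = sets borel"
  by (cases n) simp_all

lemma space_conv_power [simp]: "space (conv_power F n) = UNIV"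
  using sets_eq_imp_space_eq[OF sets_conv_power] by simp

lemma prob_space_conv_power: "prob_space (conv_power F n)"
proof (induction n)
  case (Suc n)
  interpret N: prob_space "conv_power F n" by (rule Suc)
  interpret FN: pair_prob_space F "conv_power F n" ..
  show ?case
    by (simp add: convolution_def) (rule FN.prob_space_distr, measurable)
qed (simp add: prob_space_return)

lemma measure_conv_power_Suc:
  assumes [measurable]: "A \<in> sets borel"
  shows "measure (conv_power F (Suc n)) A = (\<integral>s. measure F {x. s + x \<in> A} \<partial>conv_power F n)"
proof -
  interpret P: prob_space "conv_power F n" by (rule prob_space_conv_power)
  interpret Q: prob_space "conv_power F (Suc n)" by (rule prob_space_conv_power)
  have fin: "finite_measure F" "finite_measure (conv_power F n)"
    by unfold_locales
  have [measurable]: "(\<lambda>s. measure F {x. s + x \<in> A}) \<in> borel_measurable borel"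
    by measurable
  have "emeasure (conv_power F (Suc n)) A = emeasure (convolution (conv_power F n) F) A"
    using convolution_commutative[OF fin] by simp
  also have "\<dots> = (\<integral>\<^sup>+s. emeasure F {x. x + s \<in> A} \<partial>conv_power F n)"
    by (rule convolution_emeasure) (use fin in auto)
  also have "\<dots> = (\<integral>\<^sup>+s. ennreal (measure F {x. s + x \<in> A}) \<partial>conv_power F n)"
    by (simp add: emeasure_eq_measure add.commute)
  also have "\<dots> = ennreal (\<integral>s. measure F {x. s + x \<in> A} \<partial>conv_power F n)"
    by (rule nn_integral_eq_integral) (auto intro!: P.integrable_const_bound[where B = 1])
  finally show ?thesis
    unfolding Q.emeasure_eq_measure by (subst (asm) ennreal_inj) auto
qed

text \<open>Allowing an arbitrary finite index set makes it possible to split off any one summand, not only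
  the last.\<close>

lemma distr_sum_eq_conv_power:
  assumes "finite I"
  shows "distr (Pi\<^sub>M I (\<lambda>_. F)) borel (\<lambda>w. \<Sum>i\<in>I. w i) = conv_power F (card I)"
  using assms
proof (induction I rule: finite_induct)
  case empty
  interpret PE: prob_space "Pi\<^sub>M {} (\<lambda>_. F)" by (rule prob_space_PiM) unfold_locales
  show ?case
  proof (rule measure_eqI)
    fix A :: "'a set" 
    assume "A \<in> sets (distr (Pi\<^sub>M {} (\<lambda>_. F)) borel (\<lambda>w. \<Sum>i\<in>{}. w i))"
    then have [measurable]: "A \<in> sets borel" by simp
    show "emeasure (distr (Pi\<^sub>M {} (\<lambda>_. F)) borel (\<lambda>w. \<Sum>i\<in>{}. w i)) A =
        emeasure (conv_power F (card {})) A"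
      using PE.emeasure_space_1 by (simp add: emeasure_distr indicator_def)
  qed simp
next
  case (insert i I)
  interpret PS: product_sigma_finite "\<lambda>_. F" ..
  interpret P: prob_space "conv_power F (card I)" by (rule prob_space_conv_power)
  have [measurable]: "(\<lambda>w. \<Sum>j\<in>J. w j) \<in> borel_measurable (Pi\<^sub>M J (\<lambda>_. F))" for J
    by measurable
  have fin: "finite_measure F" "finite_measure (conv_power F (card I))"
    by unfold_locales
  show ?case
  proof (rule measure_eqI)
    fix A :: "'a set"
    assume "A \<in> sets (distr (Pi\<^sub>M (insert i I) (\<lambda>_. F)) borel (\<lambda>w. \<Sum>i\<in>insert i I. w i))"
    then have [measurable]: "A \<in> sets borel" by simp
    have "emeasure (distr (Pi\<^sub>M (insert i I) (\<lambda>_. F)) borel (\<lambda>w. \<Sum>i\<in>insert i I. w i)) A =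
        (\<integral>\<^sup>+w. indicator A (\<Sum>j\<in>insert i I. w j) \<partial>Pi\<^sub>M (insert i I) (\<lambda>_. F))"
      by (simp del: nn_integral_indicator sum.insert
        add: nn_integral_indicator[symmetric] nn_integral_distr)
    also have "\<dots> = (\<integral>\<^sup>+x. \<integral>\<^sup>+w. indicator A (\<Sum>j\<in>insert i I. (w(i := x)) j) \<partial>Pi\<^sub>M I (\<lambda>_. F) \<partial>F)"
      by (rule PS.product_nn_integral_insert_rev) (use insert in measurable)
    also have "\<dots> = (\<integral>\<^sup>+x. \<integral>\<^sup>+w. indicator A (x + (\<Sum>j\<in>I. w j)) \<partial>Pi\<^sub>M I (\<lambda>_. F) \<partial>F)"
    proof -
      have "(\<Sum>j\<in>insert i I. (w(i := x)) j) = x + (\<Sum>j\<in>I. w j)" for w :: "'b \<Rightarrow> 'a" and x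
        using insert by (auto intro!: sum.cong)
      then show ?thesis by simp
    qed
    also have "\<dots> = (\<integral>\<^sup>+x. \<integral>\<^sup>+z. indicator A (x + z)
        \<partial>distr (Pi\<^sub>M I (\<lambda>_. F)) borel (\<lambda>w. \<Sum>j\<in>I. w j) \<partial>F)"
      by (intro nn_integral_cong, subst nn_integral_distr) measurable
    also have "\<dots> = emeasure (conv_power F (card (insert i I))) A"
      using insert fin by (simp add: convolution_emeasure')
    finally show "emeasure (distr (Pi\<^sub>M (insert i I) (\<lambda>_. F)) borel (\<lambda>w. \<Sum>i\<in>insert i I. w i)) A =
        emeasure (conv_power F (card (insert i I))) A" .
  qed simp
qed

section \<open>The influence of one step on a half-space event\<close>

lemma integral_antisymmetric_eq_0:
  fixes h :: "'a \<Rightarrow> 'a \<Rightarrow> real"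
  assumes [measurable]: "case_prod h \<in> borel_measurable (F \<Otimes>\<^sub>M F)"
    and bounded: "\<And>x y. \<bar>h x y\<bar> \<le> B"
    and antisym: "\<And>x y. h y x = - h x y"
  shows "(\<integral>x. (\<integral>y. h x y \<partial>F) \<partial>F) = 0"
proof -
  interpret FF: pair_prob_space F F ..
  have "integrable (F \<Otimes>\<^sub>M F) (case_prod h)"
    by (rule FF.integrable_const_bound[where B = B]) (use bounded in auto)
  then have "(\<integral>y. (\<integral>x. h x y \<partial>F) \<partial>F) = (\<integral>x. (\<integral>y. h x y \<partial>F) \<partial>F)"
    by (rule FF.Fubini_integral)
  moreover have "(\<integral>y. (\<integral>x. h x y \<partial>F) \<partial>F) = - (\<integral>x. (\<integral>y. h x y \<partial>F) \<partial>F)"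
    by (subst antisym) simp
  ultimately show ?thesis by simp
qed

text \<open>The centred rank of \<open>x\<close> in direction \<open>t\<close>: for \<open>Y\<close> with law \<open>F\<close>, it is
  \<open>P(\<langle>Y, t\<rangle> < \<langle>x, t\<rangle>) - P(\<langle>Y, t\<rangle> > \<langle>x, t\<rangle>)\<close>.\<close>

definition rank_score :: "'a \<Rightarrow> 'a \<Rightarrow> real" where
  "rank_score t x = (\<integral>y. sgn (x \<bullet> t - y \<bullet> t) \<partial>F)"

lemma measurable_rank_score [measurable]: "rank_score t \<in> borel_measurable borel"
  unfolding rank_score_def by measurable

lemma abs_rank_score_le_1: "\<bar>rank_score t x\<bar> \<le> 1"
proof -
  have "integrable F (\<lambda>y. sgn (x \<bullet> t - y \<bullet> t))"
    by (rule integrable_const_bound[where B = 1]) (auto simp: sgn_if)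
  moreover have "\<bar>\<integral>y. sgn (x \<bullet> t - y \<bullet> t) \<partial>F\<bar> \<le> (\<integral>y. \<bar>sgn (x \<bullet> t - y \<bullet> t)\<bar> \<partial>F)"
    by (rule integral_abs_bound)
  moreover have "(\<integral>y. \<bar>sgn (x \<bullet> t - y \<bullet> t)\<bar> \<partial>F) \<le> (\<integral>y. 1 \<partial>F)"
    using \<open>integrable F (\<lambda>y. sgn (x \<bullet> t - y \<bullet> t))\<close> by (intro integral_mono) (auto simp: sgn_if)
  ultimately show ?thesis
    by (simp add: rank_score_def)
qed

lemma integrable_rank_score [simp]: "integrable F (rank_score t)"
  by (rule integrable_const_bound[where B = 1]) (auto simp: abs_rank_score_le_1)

lemma integral_rank_score: "(\<integral>x. rank_score t x \<partial>F) = 0"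
  unfolding rank_score_def
  by (rule integral_antisymmetric_eq_0[where B = 1]) (auto simp: sgn_if)

text \<open>The probability that one step from \<open>s\<close> ends above the level \<open>b\<close> in direction \<open>t\<close>.\<close>

definition tail :: "'a \<Rightarrow> real \<Rightarrow> 'a \<Rightarrow> real" where
  "tail t b s = measure F {x. b < (s + x) \<bullet> t}"

lemma measurable_tail [measurable]: "tail t b \<in> borel_measurable borel"
  unfolding tail_def by measurable

lemma tail_nonneg [simp]: "0 \<le> tail t b s" and tail_le_1 [simp]: "tail t b s \<le> 1"
  by (simp_all add: tail_def)

lemma measure_le_eq_1_minus_tail: "measure F {x. (s + x) \<bullet> t \<le> b} = 1 - tail t b s"
proof -
  have "{x. (s + x) \<bullet> t \<le> b} = space F - {x. b < (s + x) \<bullet> t}" by auto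
  then show ?thesis by (simp only: tail_def) (rule prob_compl, measurable)
qed

text \<open>Since the rank score has mean zero, this is the covariance of the rank score of the step with the
  event that the step from \<open>s\<close> ends above \<open>b\<close>.\<close>

lemma integral_tail_rank_score:
  "(\<integral>x. indicator {x. b < (s + x) \<bullet> t} x * rank_score t x \<partial>F) = tail t b s * (1 - tail t b s)"
proof -
  interpret FF: pair_prob_space F F ..
  define U where "U = {x. b < (s + x) \<bullet> t}"
  have [measurable]: "U \<in> sets borel" unfolding U_def by measurable
  have D: "(\<integral>x. indicator (- U) x \<partial>F) = 1 - tail t b s"
    using measure_le_eq_1_minus_tail[of s t b]
    by (simp add: U_def Collect_neg_eq[symmetric] not_less)
  define h where "h x y = indicator U x * indicator U y * sgn (x \<bullet> t - y \<bullet> t)" for x y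
  have [measurable]: "case_prod h \<in> borel_measurable (F \<Otimes>\<^sub>M F)" unfolding h_def by measurable
  have [measurable]: "h x \<in> borel_measurable borel" for x unfolding h_def by measurable
  have h_bound: "\<bar>h x y\<bar> \<le> 1" for x y by (auto simp: h_def sgn_if indicator_def)
  have h_int: "integrable F (h x)" for x
    by (rule integrable_const_bound[where B = 1]) (use h_bound in auto)
  \<comment> \<open>On the part where both points lie above the level the sign is antisymmetric and integrates to
    zero; if only \<open>x\<close> lies above, the sign is \<open>1\<close>.\<close>
  have split: "indicator U x * sgn (x \<bullet> t - y \<bullet> t) = indicator U x * indicator (- U) y + h x y"
    for x y by (auto simp: U_def h_def sgn_if indicator_def inner_add_left)
  have "indicator U x * rank_score t x = indicator U x * (1 - tail t b s) + (\<integral>y. h x y \<partial>F)" for x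
  proof -
    have "indicator U x * rank_score t x = (\<integral>y. indicator U x * indicator (- U) y + h x y \<partial>F)"
      unfolding rank_score_def by (simp flip: split)
    also have "\<dots> = (\<integral>y. indicator U x * indicator (- U) y \<partial>F) + (\<integral>y. h x y \<partial>F)"
      using h_int[of x] by (intro Bochner_Integration.integral_add integrable_mult_right)
        (auto simp: less_top[symmetric])
    finally show ?thesis using D by simp
  qed
  then have "(\<integral>x. indicator U x * rank_score t x \<partial>F) =
      (\<integral>x. indicator U x * (1 - tail t b s) + (\<integral>y. h x y \<partial>F) \<partial>F)" by simp
  also have "\<dots> = (\<integral>x. indicator U x * (1 - tail t b s) \<partial>F) + (\<integral>x. (\<integral>y. h x y \<partial>F) \<partial>F)"
  proof (intro Bochner_Integration.integral_add)
    have "integrable (F \<Otimes>\<^sub>M F) (case_prod h)"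
      by (rule FF.integrable_const_bound[where B = 1]) (use h_bound in auto)
    then show "integrable F (\<lambda>x. \<integral>y. h x y \<partial>F)" by (rule FF.integrable_fst)
  qed (auto simp: less_top[symmetric])
  also have "(\<integral>x. (\<integral>y. h x y \<partial>F) \<partial>F) = 0"
    by (rule integral_antisymmetric_eq_0[where B = 1])
       (use h_bound in \<open>auto simp: h_def sgn_if\<close>)
  finally show ?thesis by (simp add: U_def tail_def)
qed

text \<open>The rank scores of independent vectors are independent, centred and bounded by \<open>1\<close>.\<close>

lemma integral_square_sum_rank_score:
  assumes "finite I"
  shows "(\<integral>w. (\<Sum>i\<in>I. rank_score t (w i))\<^sup>2 \<partial>Pi\<^sub>M I (\<lambda>_. F)) \<le> card I"
  using assms
proof (induction I rule: finite_induct)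
  case (insert i I)
  interpret PS: product_sigma_finite "\<lambda>_. F" ..
  interpret PI: prob_space "Pi\<^sub>M K (\<lambda>_. F)" for K :: "'b set" by (rule prob_space_PiM) unfold_locales
  define S where "S J w = (\<Sum>i\<in>J. rank_score t (w i))" for J and w :: "'b \<Rightarrow> 'a"
  have [measurable]: "S J \<in> borel_measurable (Pi\<^sub>M J (\<lambda>_. F))" for J
    unfolding S_def by measurable
  have S_bound: "\<bar>S J w\<bar> \<le> card J" for J w
    unfolding S_def using sum_mono[of J "\<lambda>i. \<bar>rank_score t (w i)\<bar>" "\<lambda>_. 1"]
    by (intro order_trans[OF sum_abs]) (auto simp: abs_rank_score_le_1)
  have S_sq: "\<bar>(S J w)\<^sup>2\<bar> \<le> (real (card J))\<^sup>2" for J w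
    using S_bound[of J w] by (simp add: abs_le_square_iff[symmetric])
  have S_int: "integrable (Pi\<^sub>M J (\<lambda>_. F)) (\<lambda>w. (S J w)\<^sup>2)" for J
    by (rule PI.integrable_const_bound[where B = "(real (card J))\<^sup>2"]) (use S_sq in auto)
  have g2: "integrable F (\<lambda>x. (rank_score t x)\<^sup>2)"
    by (rule integrable_const_bound[where B = 1]) (auto simp: abs_square_le_1 abs_rank_score_le_1)
  have g2_le: "(\<integral>x. (rank_score t x)\<^sup>2 \<partial>F) \<le> 1"
  proof -
    have "(\<integral>x. (rank_score t x)\<^sup>2 \<partial>F) \<le> (\<integral>x. 1 \<partial>F)"
      using g2 by (intro integral_mono) (auto simp: abs_square_le_1 abs_rank_score_le_1)
    then show ?thesis by (simp add: prob_space)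
  qed
  have "(\<integral>w. (S (insert i I) w)\<^sup>2 \<partial>Pi\<^sub>M (insert i I) (\<lambda>_. F)) =
      (\<integral>w. (\<integral>x. (S (insert i I) (w(i := x)))\<^sup>2 \<partial>F) \<partial>Pi\<^sub>M I (\<lambda>_. F))"
    using insert S_int by (intro PS.product_integral_insert) auto
  also have "\<dots> = (\<integral>w. (S I w)\<^sup>2 + (\<integral>x. (rank_score t x)\<^sup>2 \<partial>F) \<partial>Pi\<^sub>M I (\<lambda>_. F))"
  proof (intro Bochner_Integration.integral_cong refl)
    fix w :: "'b \<Rightarrow> 'a"
    have "S (insert i I) (w(i := x)) = S I w + rank_score t x" for x
      using insert by (auto simp: S_def intro!: sum.cong)
    then have "(\<integral>x. (S (insert i I) (w(i := x)))\<^sup>2 \<partial>F) =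
        (\<integral>x. (S I w)\<^sup>2 + 2 * S I w * rank_score t x + (rank_score t x)\<^sup>2 \<partial>F)"
      by (simp add: power2_sum algebra_simps)
    also have "\<dots> = (S I w)\<^sup>2 + (\<integral>x. (rank_score t x)\<^sup>2 \<partial>F)"
      using g2 by (simp add: integral_rank_score prob_space)
    finally show "(\<integral>x. (S (insert i I) (w(i := x)))\<^sup>2 \<partial>F) =
        (S I w)\<^sup>2 + (\<integral>x. (rank_score t x)\<^sup>2 \<partial>F)" .
  qed
  also have "\<dots> = (\<integral>w. (S I w)\<^sup>2 \<partial>Pi\<^sub>M I (\<lambda>_. F)) + (\<integral>x. (rank_score t x)\<^sup>2 \<partial>F)"
    using S_int PI.prob_space by simp
  also have "\<dots> \<le> card I + 1"
    using insert.IH g2_le by (simp add: S_def)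
  finally show ?case
    using insert by (simp add: S_def)
qed simp

text \<open>The influence bound: the integrand is the probability that, of two independent steps from \<open>s\<close>,
  the first ends above \<open>b\<close> and the second does not. The constant does not depend on \<open>F\<close>.\<close>

lemma integral_tail_variance_le:
  "(\<integral>s. tail t b s * (1 - tail t b s) \<partial>conv_power F k) \<le> 1 / sqrt (real (Suc k))"
proof -
  define J where "J = {..k}"
  have card_J: "card J = Suc k" and [simp]: "finite J"
    by (simp_all add: J_def)
  define n where "n = real (Suc k)"
  interpret PS: product_sigma_finite "\<lambda>_. F" ..
  interpret PI: prob_space "Pi\<^sub>M K (\<lambda>_. F)" for K :: "nat set"
    by (rule prob_space_PiM) unfold_locales
  define v where "v s = tail t b s * (1 - tail t b s)" for s
  have [measurable]: "v \<in> borel_measurable borel" unfolding v_def by measurable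
  define f :: "(nat \<Rightarrow> 'a) \<Rightarrow> real"
    where "f w = indicator {x. b < x \<bullet> t} (\<Sum>j\<in>J. w j)" for w
  define S where "S w = (\<Sum>i\<in>J. rank_score t (w i))" for w :: "nat \<Rightarrow> 'a"
  have [measurable]: "f \<in> borel_measurable (Pi\<^sub>M J (\<lambda>_. F))"
      "S \<in> borel_measurable (Pi\<^sub>M J (\<lambda>_. F))"
    unfolding f_def S_def by measurable
  have f_int: "integrable (Pi\<^sub>M J (\<lambda>_. F)) (\<lambda>w. f w * rank_score t (w i))" if "i \<in> J" for i
    by (rule PI.integrable_const_bound[where B = 1])
       (use that abs_rank_score_le_1 in \<open>auto simp: f_def indicator_def\<close>)
  \<comment> \<open>Splitting off the summand \<open>i\<close>: the remaining \<open>k\<close> summands have law \<open>conv_power F k\<close>, whatever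
    \<open>i\<close> is.\<close>
  have single: "(\<integral>w. f w * rank_score t (w i) \<partial>Pi\<^sub>M J (\<lambda>_. F)) = (\<integral>s. v s \<partial>conv_power F k)"
    if i: "i \<in> J" for i
  proof -
    define I where "I = J - {i}"
    have I: "finite I" "i \<notin> I" "insert i I = J" "card I = k"
      using i card_J by (auto simp: I_def)
    have "(\<integral>w. f w * rank_score t (w i) \<partial>Pi\<^sub>M J (\<lambda>_. F)) =
        (\<integral>w. (\<integral>x. f (w(i := x)) * rank_score t ((w(i := x)) i) \<partial>F) \<partial>Pi\<^sub>M I (\<lambda>_. F))"
      using PS.product_integral_insert[OF I(1,2), unfolded I(3), OF f_int[OF i]] .
    also have "\<dots> = (\<integral>w. v (\<Sum>j\<in>I. w j) \<partial>Pi\<^sub>M I (\<lambda>_. F))"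
    proof (intro Bochner_Integration.integral_cong refl)
      fix w :: "nat \<Rightarrow> 'a"
      have "(\<Sum>j\<in>J. (w(i := x)) j) = (\<Sum>j\<in>I. w j) + x" for x
        using I unfolding I(3)[symmetric] by (auto intro!: sum.cong)
      then have "f (w(i := x)) = indicator {x. b < ((\<Sum>j\<in>I. w j) + x) \<bullet> t} x" for x
        by (simp add: f_def indicator_def)
      then show "(\<integral>x. f (w(i := x)) * rank_score t ((w(i := x)) i) \<partial>F) = v (\<Sum>j\<in>I. w j)"
        by (simp add: integral_tail_rank_score v_def)
    qed
    also have "\<dots> = (\<integral>s. v s \<partial>distr (Pi\<^sub>M I (\<lambda>_. F)) borel (\<lambda>w. \<Sum>j\<in>I. w j))"
      by (subst integral_distr) measurable
    finally show ?thesis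
      using distr_sum_eq_conv_power[OF I(1)] I(4) by simp
  qed
  have S_bound: "\<bar>S w\<bar> \<le> card J" for w
    unfolding S_def using sum_mono[of J "\<lambda>i. \<bar>rank_score t (w i)\<bar>" "\<lambda>_. 1"]
    by (intro order_trans[OF sum_abs]) (auto simp: abs_rank_score_le_1)
  have S_sq: "\<bar>(S w)\<^sup>2\<bar> \<le> (real (card J))\<^sup>2" for w
    using S_bound[of w] by (simp add: abs_le_square_iff[symmetric])
  have S_int: "integrable (Pi\<^sub>M J (\<lambda>_. F)) (\<lambda>w. (S w)\<^sup>2)"
    by (rule PI.integrable_const_bound[where B = "(real (card J))\<^sup>2"]) (use S_sq in auto)
  have n: "n > 0" by (simp add: n_def)
  \<comment> \<open>This replaces the Cauchy-Schwarz inequality: both terms on the right have mean at most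
    \<open>sqrt n / 2\<close>.\<close>
  have amgm: "f w * S w \<le> ((S w)\<^sup>2 / sqrt n + sqrt n) / 2" for w
  proof -
    have "2 * \<bar>S w\<bar> * sqrt n \<le> (S w)\<^sup>2 + n"
      using sum_squares_bound[of "\<bar>S w\<bar>" "sqrt n"] n by simp
    then have "\<bar>S w\<bar> \<le> ((S w)\<^sup>2 / sqrt n + sqrt n) / 2"
      using n by (simp add: field_simps)
    moreover have "f w * S w \<le> \<bar>S w\<bar>" by (auto simp: f_def indicator_def)
    ultimately show ?thesis by linarith
  qed
  have "n * (\<integral>s. v s \<partial>conv_power F k) =
      (\<Sum>i\<in>J. \<integral>w. f w * rank_score t (w i) \<partial>Pi\<^sub>M J (\<lambda>_. F))"
    using single card_J by (simp add: n_def)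
  also have "\<dots> = (\<integral>w. f w * S w \<partial>Pi\<^sub>M J (\<lambda>_. F))"
    using f_int by (simp add: S_def sum_distrib_left)
  also have "\<dots> \<le> (\<integral>w. ((S w)\<^sup>2 / sqrt n + sqrt n) / 2 \<partial>Pi\<^sub>M J (\<lambda>_. F))"
  proof (rule integral_mono)
    show "integrable (Pi\<^sub>M J (\<lambda>_. F)) (\<lambda>w. f w * S w)"
      using f_int by (simp add: S_def sum_distrib_left)
  qed (use S_int amgm in auto)
  also have "\<dots> = ((\<integral>w. (S w)\<^sup>2 \<partial>Pi\<^sub>M J (\<lambda>_. F)) / sqrt n + sqrt n) / 2"
    using S_int PI.prob_space by simp
  also have "\<dots> \<le> (n / sqrt n + sqrt n) / 2"
    using integral_square_sum_rank_score[OF \<open>finite J\<close>, of t] card_J n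
    by (simp add: S_def n_def divide_right_mono)
  also have "\<dots> = n * (1 / sqrt n)" using n by (simp add: real_div_sqrt)
  finally have "(\<integral>s. v s \<partial>conv_power F k) \<le> 1 / sqrt n"
    using n mult_le_cancel_left_pos by blast
  then show ?thesis by (simp only: v_def n_def)
qed

lemma integrable_tail_variance [simp]:
  "integrable (conv_power F n) (\<lambda>s. tail t b s * (1 - tail t b s))"
proof -
  interpret N: prob_space "conv_power F n" by (rule prob_space_conv_power)
  show ?thesis
    by (rule N.integrable_const_bound[where B = 1]) (auto simp: abs_mult intro!: mult_le_one)
qed

section \<open>Concentration of convolution powers\<close>

text \<open>A step of size more than \<open>u + \<delta>\<close> that ends in the window of length \<open>\<delta>\<close> above \<open>b\<close> would end at
  most at \<open>b\<close> if it were replaced by a step of size at most \<open>u\<close>; a smaller step would end above \<open>b + \<delta>\<close>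
  if it were replaced by a step of size at least \<open>w\<close>. In both cases resampling the step crosses an end
  of the window.\<close>

lemma measure_window_le_tail_variance:
  fixes u w :: real
  defines "\<delta> \<equiv> (w - u) / 3"
  assumes "u < w" and q: "measure F {y. y \<bullet> t \<le> u} > 0" and p: "measure F {y. w \<le> y \<bullet> t} > 0"
  shows "measure F {x. b < (s + x) \<bullet> t \<and> (s + x) \<bullet> t \<le> b + \<delta>} \<le>
    tail t b s * (1 - tail t b s) / measure F {y. y \<bullet> t \<le> u} +
    tail t (b + \<delta>) s * (1 - tail t (b + \<delta>) s) / measure F {y. w \<le> y \<bullet> t}"
    (is "?L \<le> _ / ?q + _ / ?p")
proof -
  have "3 * \<delta> = w - u" by (simp add: \<delta>_def)
  with assms(2) have \<delta>: "\<delta> > 0" "w = u + 3 * \<delta>" by linarith+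
  define A where "A = {x. b < (s + x) \<bullet> t \<and> (s + x) \<bullet> t \<le> b + \<delta> \<and> u + \<delta> < x \<bullet> t}"
  define B where "B = {x. b < (s + x) \<bullet> t \<and> (s + x) \<bullet> t \<le> b + \<delta> \<and> x \<bullet> t \<le> u + \<delta>}"
  have [measurable]: "A \<in> sets F" "B \<in> sets F" unfolding A_def B_def by measurable
  have A_le: "measure F A \<le> tail t b s * (1 - tail t b s) / ?q"
  proof (cases "A = {}")
    case False
    then obtain x where x: "x \<in> A" by blast
    have "?q \<le> measure F {y. (s + y) \<bullet> t \<le> b}"
      by (rule finite_measure_mono) (use x in \<open>auto simp: A_def inner_add_left\<close>)
    then have "?q \<le> 1 - tail t b s" by (simp add: measure_le_eq_1_minus_tail)
    moreover have "measure F A \<le> tail t b s"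
      unfolding tail_def by (rule finite_measure_mono) (auto simp: A_def)
    ultimately have "measure F A * ?q \<le> tail t b s * (1 - tail t b s)"
      by (intro mult_mono) auto
    then show ?thesis using q by (simp add: field_simps)
  qed (use q in simp)
  have B_le: "measure F B \<le> tail t (b + \<delta>) s * (1 - tail t (b + \<delta>) s) / ?p"
  proof (cases "B = {}")
    case False
    then obtain x where x: "x \<in> B" by blast
    have "?p \<le> tail t (b + \<delta>) s"
      unfolding tail_def
      by (rule finite_measure_mono) (use x \<delta> in \<open>auto simp: B_def inner_add_left\<close>)
    moreover have "measure F B \<le> measure F {y. (s + y) \<bullet> t \<le> b + \<delta>}"
      by (rule finite_measure_mono) (auto simp: B_def)
    then have "measure F B \<le> 1 - tail t (b + \<delta>) s" by (simp add: measure_le_eq_1_minus_tail)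
    ultimately have "?p * measure F B \<le> tail t (b + \<delta>) s * (1 - tail t (b + \<delta>) s)"
      by (intro mult_mono) auto
    then show ?thesis using p by (simp add: field_simps)
  qed (use p in simp)
  have "?L = measure F (A \<union> B)"
    by (rule arg_cong[where f = "measure F"]) (auto simp: A_def B_def)
  also have "\<dots> \<le> measure F A + measure F B"
    by (rule measure_Un_le) measurable
  finally show ?thesis using A_le B_le by linarith
qed

lemma conv_power_short_window_le:
  fixes u w :: real
  assumes "u < w" and q: "measure F {y. y \<bullet> t \<le> u} > 0" and p: "measure F {y. w \<le> y \<bullet> t} > 0"
    and "n \<ge> 1"
  shows "measure (conv_power F n) {z. b < z \<bullet> t \<and> z \<bullet> t \<le> b + (w - u) / 3} \<le>
    (1 / measure F {y. y \<bullet> t \<le> u} + 1 / measure F {y. w \<le> y \<bullet> t}) / sqrt n"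
    (is "_ \<le> (1 / ?q + 1 / ?p) / _")
proof -
  obtain k where n: "n = Suc k" using \<open>n \<ge> 1\<close> by (cases n) auto
  interpret N: prob_space "conv_power F k" by (rule prob_space_conv_power)
  define v where "v b s = tail t b s * (1 - tail t b s)" for b s
  define \<delta> where "\<delta> = (w - u) / 3"
  have v_int: "integrable (conv_power F k) (v b)" for b unfolding v_def by simp
  have "measure (conv_power F n) {z. b < z \<bullet> t \<and> z \<bullet> t \<le> b + \<delta>} =
      (\<integral>s. measure F {x. b < (s + x) \<bullet> t \<and> (s + x) \<bullet> t \<le> b + \<delta>} \<partial>conv_power F k)"
    unfolding n by (subst measure_conv_power_Suc) auto
  also have "\<dots> \<le> (\<integral>s. v b s / ?q + v (b + \<delta>) s / ?p \<partial>conv_power F k)"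
  proof (rule integral_mono)
    show "integrable (conv_power F k)
        (\<lambda>s. measure F {x. b < (s + x) \<bullet> t \<and> (s + x) \<bullet> t \<le> b + \<delta>})"
      by (rule N.integrable_const_bound[where B = 1]) auto
  qed (use v_int measure_window_le_tail_variance[OF assms(1) q p] in \<open>auto simp: v_def \<delta>_def\<close>)
  also have "\<dots> = (\<integral>s. v b s \<partial>conv_power F k) / ?q + (\<integral>s. v (b + \<delta>) s \<partial>conv_power F k) / ?p"
    using v_int by simp
  also have "\<dots> \<le> (1 / sqrt n) / ?q + (1 / sqrt n) / ?p"
    unfolding n v_def by (intro add_mono divide_right_mono integral_tail_variance_le) auto
  finally show ?thesis by (simp add: \<delta>_def add_divide_distrib mult.commute)
qed

lemma nondegenerate_imp_two_sided_mass:
  assumes nondeg: "\<not> (\<exists>a. AE x in F. x \<bullet> t = a)"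
  obtains u w where "u < w" "measure F {y. y \<bullet> t \<le> u} > 0" "measure F {y. w \<le> y \<bullet> t} > 0"
proof (rule ccontr)
  note witness = that
  assume "\<not> thesis"
  then have sep: "measure F {y. y \<bullet> t \<le> u} = 0 \<or> measure F {y. w \<le> y \<bullet> t} = 0" if "u < w" for u w
    using that witness[of u w] by (auto simp: zero_less_measure_iff)
  have le_null: "measure F {y. y \<bullet> t \<le> u} = 0 \<longleftrightarrow> (AE x in F. u < x \<bullet> t)" for u
    using prob_Collect_eq_0[of "\<lambda>y. y \<bullet> t \<le> u"] by (simp add: not_le)
  have ge_null: "measure F {y. w \<le> y \<bullet> t} = 0 \<longleftrightarrow> (AE x in F. x \<bullet> t < w)" for w
    using prob_Collect_eq_0[of "\<lambda>y. w \<le> y \<bullet> t"] by (simp add: not_le)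
  \<comment> \<open>If no such \<open>u\<close> and \<open>w\<close> exist, all the mass sits at the supremum of \<open>Z\<close>, the essential infimum
    of \<open>\<langle>x, t\<rangle>\<close>.\<close>
  define Z where "Z = {u. AE x in F. u < x \<bullet> t}"
  have not_all_below: "\<not> (\<forall>w. AE x in F. x \<bullet> t < w)"
  proof
    assume "\<forall>w. AE x in F. x \<bullet> t < w"
    then have "AE x in F. \<forall>k::nat. x \<bullet> t < - real k" by (subst AE_all_countable) blast
    then have "AE x in F. False"
    proof eventually_elim
      case (elim x)
      obtain k :: nat where "- (x \<bullet> t) < real k" using reals_Archimedean2 by blast
      with elim show False by (auto dest: spec[of _ k])
    qed
    then show False by simp
  qed
  have not_all_above: "\<not> (\<forall>u. AE x in F. u < x \<bullet> t)"
  proof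
    assume "\<forall>u. AE x in F. u < x \<bullet> t"
    then have "AE x in F. \<forall>k::nat. real k < x \<bullet> t" by (subst AE_all_countable) blast
    then have "AE x in F. False"
    proof eventually_elim
      case (elim x)
      obtain k :: nat where "x \<bullet> t < real k" using reals_Archimedean2 by blast
      with elim show False by (auto dest: spec[of _ k])
    qed
    then show False by simp
  qed
  obtain w0 where "\<not> (AE x in F. x \<bullet> t < w0)" using not_all_below by blast
  then have "w0 - 1 \<in> Z" using sep[of "w0 - 1" w0] by (auto simp: Z_def le_null ge_null)
  obtain u0 where u0: "\<not> (AE x in F. u0 < x \<bullet> t)" using not_all_above by blast
  have bdd: "bdd_above Z"
  proof (rule bdd_aboveI)
    fix u assume u: "u \<in> Z"
    show "u \<le> u0"
    proof (rule ccontr)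
      assume "\<not> u \<le> u0"
      then have "AE x in F. u0 < x \<bullet> t" using u by (auto simp: Z_def elim!: eventually_mono)
      then show False using u0 by simp
    qed
  qed
  define a where "a = Sup Z"
  have "AE x in F. \<forall>r\<in>{r\<in>\<rat>. r < a}. r < x \<bullet> t"
  proof (subst AE_ball_countable)
    show "\<forall>r\<in>{r\<in>\<rat>. r < a}. AE x in F. r < x \<bullet> t"
    proof
      fix r assume "r \<in> {r\<in>\<rat>. r < a}"
      then obtain u where "u \<in> Z" "r < u"
        using less_cSup_iff[OF _ bdd, of r] \<open>w0 - 1 \<in> Z\<close> by (auto simp: a_def)
      then show "AE x in F. r < x \<bullet> t" by (auto simp: Z_def elim!: eventually_mono)
    qed
  qed (auto intro: countable_subset[OF _ countable_rat])
  moreover have "AE x in F. \<forall>r\<in>{r\<in>\<rat>. a < r}. x \<bullet> t < r"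
  proof (subst AE_ball_countable)
    show "\<forall>r\<in>{r\<in>\<rat>. a < r}. AE x in F. x \<bullet> t < r"
    proof
      fix r assume "r \<in> {r\<in>\<rat>. a < r}"
      then obtain u where u: "a < u" "u < r" using dense by auto
      then have "u \<notin> Z" using cSup_upper[OF _ bdd, of u] by (auto simp: a_def)
      then show "AE x in F. x \<bullet> t < r" using sep[OF u(2)] by (auto simp: Z_def le_null ge_null)
    qed
  qed (auto intro: countable_subset[OF _ countable_rat])
  ultimately have "AE x in F. x \<bullet> t = a"
  proof eventually_elim
    case (elim x)
    show ?case
    proof (rule linorder_cases[of "x \<bullet> t" a])
      assume "x \<bullet> t < a"
      then obtain r where "r \<in> \<rat>" "x \<bullet> t < r" "r < a" using Rats_dense_in_real by blast
      with elim show ?thesis by force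
    next
      assume "a < x \<bullet> t"
      then obtain r where "r \<in> \<rat>" "a < r" "r < x \<bullet> t" using Rats_dense_in_real by blast
      with elim show ?thesis by force
    qed
  qed
  with nondeg show False by blast
qed

lemma measure_long_window_le:
  fixes f :: "'b \<Rightarrow> real"
  assumes "finite_measure M" and [measurable]: "f \<in> borel_measurable M"
    and "\<delta> > 0"
    and short: "\<And>b. measure M {x \<in> space M. b < f x \<and> f x \<le> b + \<delta>} \<le> c"
  shows "measure M {x \<in> space M. b < f x \<and> f x \<le> b + L} \<le> real (nat \<lceil>L / \<delta>\<rceil>) * c"
proof -
  interpret M: finite_measure M by fact
  have *: "measure M {x \<in> space M. b < f x \<and> f x \<le> b + real k * \<delta>} \<le> real k * c" for k
  proof (induction k)
    case 0
    have "{x \<in> space M. b < f x \<and> f x \<le> b + real 0 * \<delta>} = {}" by auto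
    then show ?case by (simp only:) simp
  next
    case (Suc k)
    let ?b' = "b + real k * \<delta>"
    have "measure M {x \<in> space M. b < f x \<and> f x \<le> b + real (Suc k) * \<delta>} \<le>
        measure M ({x \<in> space M. b < f x \<and> f x \<le> ?b'} \<union>
          {x \<in> space M. ?b' < f x \<and> f x \<le> ?b' + \<delta>})"
      by (rule M.finite_measure_mono) (auto simp: algebra_simps)
    also have "\<dots> \<le> measure M {x \<in> space M. b < f x \<and> f x \<le> ?b'} +
        measure M {x \<in> space M. ?b' < f x \<and> f x \<le> ?b' + \<delta>}"
      by (rule measure_Un_le) measurable
    also have "\<dots> \<le> real k * c + c" by (intro add_mono Suc.IH short)
    finally show ?case by (simp add: algebra_simps)
  qed
  have "L / \<delta> \<le> real (nat \<lceil>L / \<delta>\<rceil>)" by linarith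
  then have "L \<le> real (nat \<lceil>L / \<delta>\<rceil>) * \<delta>" using \<open>\<delta> > 0\<close> by (simp add: field_simps)
  then have "measure M {x \<in> space M. b < f x \<and> f x \<le> b + L} \<le>
      measure M {x \<in> space M. b < f x \<and> f x \<le> b + real (nat \<lceil>L / \<delta>\<rceil>) * \<delta>}"
    by (intro M.finite_measure_mono) auto
  also have "\<dots> \<le> real (nat \<lceil>L / \<delta>\<rceil>) * c" by (rule *)
  finally show ?thesis .
qed

lemma conv_power_concentration:
  assumes "\<not> (\<exists>a. AE x in F. x \<bullet> t = a)"
  obtains C where "C \<ge> 0"
    "\<And>n b. n \<ge> 1 \<Longrightarrow> measure (conv_power F n) {z. b < z \<bullet> t \<and> z \<bullet> t \<le> b + L} \<le> C / sqrt n"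
proof -
  obtain u w where uw: "u < w" "measure F {y. y \<bullet> t \<le> u} > 0" "measure F {y. w \<le> y \<bullet> t} > 0"
    using nondegenerate_imp_two_sided_mass[OF assms] .
  define c where "c = 1 / measure F {y. y \<bullet> t \<le> u} + 1 / measure F {y. w \<le> y \<bullet> t}"
  define k where "k = nat \<lceil>L / ((w - u) / 3)\<rceil>"
  show thesis
  proof (rule that[of "real k * c"])
    show "real k * c \<ge> 0" by (simp add: c_def)
    fix n :: nat and b :: real assume n: "n \<ge> 1"
    interpret N: prob_space "conv_power F n" by (rule prob_space_conv_power)
    have "measure (conv_power F n) {z \<in> space (conv_power F n). b < z \<bullet> t \<and> z \<bullet> t \<le> b + L} \<le>
        real k * (c / sqrt n)"
      unfolding k_def
    proof (rule measure_long_window_le[where f = "\<lambda>z. z \<bullet> t"])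
      show "finite_measure (conv_power F n)" by unfold_locales
      fix b
      show "measure (conv_power F n) {z \<in> space (conv_power F n). b < z \<bullet> t \<and> z \<bullet> t \<le> b + (w - u) / 3} \<le> c / sqrt n"
        using conv_power_short_window_le[OF uw n] by (simp add: c_def)
    qed (use uw in auto)
    then show "measure (conv_power F n) {z. b < z \<bullet> t \<and> z \<bullet> t \<le> b + L} \<le> real k * c / sqrt n"
      by simp
  qed
qed

lemma exists_half_mass_window:
  obtains L where "measure F {x. \<bar>x \<bullet> t\<bar> \<le> L} \<ge> 1 / 2"
proof -
  define A where "A k = {x. \<bar>x \<bullet> t\<bar> \<le> real k}" for k
  have "(\<lambda>k. measure F (A k)) \<longlonglongrightarrow> measure F (\<Union>k. A k)"
  proof (rule finite_Lim_measure_incseq)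
    show "range A \<subseteq> sets F" unfolding A_def by auto
    show "incseq A" by (auto simp: A_def incseq_def)
  qed
  moreover have "(\<Union>k. A k) = UNIV" by (auto simp: A_def real_arch_simple)
  ultimately have "(\<lambda>k. measure F (A k)) \<longlonglongrightarrow> 1" by simp
  then have "eventually (\<lambda>k. 1 / 2 < measure F (A k)) sequentially"
    by (rule order_tendstoD(1)) simp
  then obtain k where "1 / 2 < measure F (A k)" by (auto simp: eventually_sequentially)
  then show thesis using that[of "real k"] by (simp add: A_def)
qed

section \<open>Crossing the boundary of a set in one step\<close>

text \<open>The probability that one step from \<open>s\<close> enters or leaves \<open>A\<close>.\<close>

definition crossing :: "'a set \<Rightarrow> 'a \<Rightarrow> real" where
  "crossing A s = measure F {x. s + x \<in> A \<longleftrightarrow> s \<notin> A}"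

lemma measurable_crossing [measurable]:
  assumes [measurable]: "A \<in> sets borel"
  shows "crossing A \<in> borel_measurable borel"
  unfolding crossing_def by measurable

lemma crossing_nonneg [simp]: "0 \<le> crossing A s" and crossing_le_1 [simp]: "crossing A s \<le> 1"
  by (simp_all add: crossing_def)

lemma integrable_crossing [simp]:
  assumes [measurable]: "A \<in> sets borel"
  shows "integrable (conv_power F n) (crossing A)"
proof -
  interpret N: prob_space "conv_power F n" by (rule prob_space_conv_power)
  show ?thesis by (rule N.integrable_const_bound[where B = 1]) auto
qed

lemma conv_power_diff_le_crossing:
  assumes [measurable]: "A \<in> sets borel"
  shows "\<bar>measure (conv_power F n) A - measure (conv_power F (Suc n)) A\<bar> \<le>
    (\<integral>s. crossing A s \<partial>conv_power F n)"
proof -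
  interpret N: prob_space "conv_power F n" by (rule prob_space_conv_power)
  define h where "h s = measure F {x. s + x \<in> A}" for s
  have [measurable]: "h \<in> borel_measurable borel" unfolding h_def by measurable
  have h_int: "integrable (conv_power F n) h"
    by (rule N.integrable_const_bound[where B = 1]) (auto simp: h_def)
  have ind_int: "integrable (conv_power F n) (indicator A :: 'a \<Rightarrow> real)"
    by (rule N.integrable_const_bound[where B = 1]) auto
  have pointwise: "\<bar>indicator A s - h s\<bar> \<le> crossing A s" for s
  proof (cases "s \<in> A")
    case True
    have "{x. s + x \<notin> A} = space F - {x. s + x \<in> A}" by auto
    then have "measure F {x. s + x \<notin> A} = 1 - h s"
      unfolding h_def by (simp only:) (rule prob_compl, measurable)
    with True show ?thesis by (simp add: crossing_def) (simp add: h_def)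
  qed (simp add: crossing_def h_def)
  have "measure (conv_power F n) A - measure (conv_power F (Suc n)) A =
      (\<integral>s. indicator A s - h s \<partial>conv_power F n)"
    using h_int ind_int measure_conv_power_Suc[OF assms, of n]
    by (simp add: h_def[symmetric] del: conv_power.simps)
  then have "\<bar>measure (conv_power F n) A - measure (conv_power F (Suc n)) A\<bar> \<le>
      (\<integral>s. \<bar>indicator A s - h s\<bar> \<partial>conv_power F n)"
    by (simp only: integral_abs_bound)
  also have "\<dots> \<le> (\<integral>s. crossing A s \<partial>conv_power F n)"
    using h_int ind_int pointwise by (intro integral_mono) auto
  finally show ?thesis .
qed

lemma crossing_INT_le:
  assumes "finite I" and [measurable]: "\<And>i. i \<in> I \<Longrightarrow> A i \<in> sets borel"
  shows "crossing (\<Inter>i\<in>I. A i) s \<le> (\<Sum>i\<in>I. crossing (A i) s)"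
proof -
  define E where "E i = {x. s + x \<in> A i \<longleftrightarrow> s \<notin> A i}" for i
  have E: "E ` I \<subseteq> sets F" unfolding E_def by auto
  have "crossing (\<Inter>i\<in>I. A i) s \<le> measure F (\<Union>i\<in>I. E i)"
    unfolding crossing_def
    by (rule finite_measure_mono) (use E assms(1) in \<open>auto simp: E_def\<close>)
  also have "\<dots> \<le> (\<Sum>i\<in>I. measure F (E i))"
    by (rule finite_measure_subadditive_finite[OF assms(1) E])
  finally show ?thesis by (simp add: E_def crossing_def)
qed

lemma crossing_halfspace_le:
  assumes L: "measure F {x. \<bar>x \<bullet> t\<bar> \<le> L} \<ge> 1 / 2"
  shows "crossing {x. x \<bullet> t \<le> b} s \<le>
    indicator {z. b - L < z \<bullet> t \<and> z \<bullet> t \<le> b + L} s + 2 * (tail t b s * (1 - tail t b s))"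
proof -
  let ?r = "tail t b s"
  have cr: "crossing {x. x \<bullet> t \<le> b} s = (if s \<bullet> t \<le> b then ?r else 1 - ?r)"
    using measure_le_eq_1_minus_tail[of s t b] by (simp add: crossing_def tail_def not_le)
  consider "b - L < s \<bullet> t \<and> s \<bullet> t \<le> b + L" | "s \<bullet> t \<le> b" "s \<bullet> t \<le> b - L" | "b < s \<bullet> t" "b + L < s \<bullet> t"
    by linarith
  then show ?thesis
  proof cases
    case 1
    then have "indicator {z. b - L < z \<bullet> t \<and> z \<bullet> t \<le> b + L} s = (1 :: real)" by simp
    moreover have "0 \<le> 2 * (?r * (1 - ?r))" by simp
    ultimately show ?thesis
      using crossing_le_1[of "{x. x \<bullet> t \<le> b}" s] by linarith
  next
    case 2
    have "measure F {x. \<bar>x \<bullet> t\<bar> \<le> L} \<le> measure F {x. (s + x) \<bullet> t \<le> b}"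
      by (rule finite_measure_mono) (use 2 in \<open>auto simp: inner_add_left\<close>)
    then have "1 / 2 \<le> 1 - ?r" using L by (simp add: measure_le_eq_1_minus_tail)
    then have "?r * (1 / 2) \<le> ?r * (1 - ?r)" by (intro mult_left_mono) auto
    then show ?thesis using 2 by (simp add: cr)
  next
    case 3
    have "measure F {x. \<bar>x \<bullet> t\<bar> \<le> L} \<le> ?r"
      unfolding tail_def by (rule finite_measure_mono) (use 3 in \<open>auto simp: inner_add_left\<close>)
    then have "(1 / 2) * (1 - ?r) \<le> ?r * (1 - ?r)" using L by (intro mult_right_mono) auto
    then show ?thesis using 3 by (simp add: cr)
  qed
qed

text \<open>The level \<open>b\<close> is extended real, so that the whole space and the empty set count as
  half-spaces.\<close>

lemma integral_crossing_halfspace_le: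
  assumes t: "\<not> (\<exists>a. AE x in F. x \<bullet> t = a) \<or> (AE x in F. x \<bullet> t = 0)"
  obtains C where "C \<ge> 0" "\<And>n b. n \<ge> 1 \<Longrightarrow>
    (\<integral>s. crossing {x. ereal (x \<bullet> t) \<le> b} s \<partial>conv_power F n) \<le> C / sqrt n"
proof (cases "AE x in F. x \<bullet> t = 0")
  case True
  have "crossing {x. ereal (x \<bullet> t) \<le> b} s = 0" for b s
  proof -
    have "AE x in F. \<not> (ereal ((s + x) \<bullet> t) \<le> b \<longleftrightarrow> \<not> ereal (s \<bullet> t) \<le> b)"
      using True by eventually_elim (auto simp: inner_add_left)
    then show ?thesis
      unfolding crossing_def mem_Collect_eq
      by (subst prob_Collect_eq_0[of "\<lambda>x. ereal ((s + x) \<bullet> t) \<le> b \<longleftrightarrow> \<not> ereal (s \<bullet> t) \<le> b", simplified]) auto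
  qed
  then show thesis using that[of 0] by simp
next
  case False
  then have nondeg: "\<not> (\<exists>a. AE x in F. x \<bullet> t = a)" using t by blast
  obtain L where L: "measure F {x. \<bar>x \<bullet> t\<bar> \<le> L} \<ge> 1 / 2"
    using exists_half_mass_window .
  obtain C where C: "C \<ge> 0" "\<And>n b. n \<ge> 1 \<Longrightarrow>
      measure (conv_power F n) {z. b < z \<bullet> t \<and> z \<bullet> t \<le> b + 2 * L} \<le> C / sqrt n"
    using conv_power_concentration[OF nondeg, of "2 * L"] by blast
  have real_bound: "(\<integral>s. crossing {x. x \<bullet> t \<le> b} s \<partial>conv_power F n) \<le> (C + 2) / sqrt n"
    if n: "n \<ge> 1" for n b
  proof -
    interpret N: prob_space "conv_power F n" by (rule prob_space_conv_power)
    define W where "W = {z. b - L < z \<bullet> t \<and> z \<bullet> t \<le> b + L}"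
    have [measurable]: "W \<in> sets borel" unfolding W_def by measurable
    have W_int: "integrable (conv_power F n) (indicator W :: 'a \<Rightarrow> real)"
      by (rule N.integrable_const_bound[where B = 1]) auto
    have W_le: "measure (conv_power F n) W \<le> C / sqrt n"
      using C(2)[OF n, of "b - L"] by (simp add: W_def add.commute)
    have "(\<integral>s. crossing {x. x \<bullet> t \<le> b} s \<partial>conv_power F n) \<le>
        (\<integral>s. indicator W s + 2 * (tail t b s * (1 - tail t b s)) \<partial>conv_power F n)"
      using W_int crossing_halfspace_le[OF L, of b] by (intro integral_mono) (auto simp: W_def)
    also have "\<dots> = measure (conv_power F n) W +
        2 * (\<integral>s. tail t b s * (1 - tail t b s) \<partial>conv_power F n)"
      using W_int by simp
    also have "\<dots> \<le> C / sqrt n + 2 * (1 / sqrt (Suc n))"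
      using W_le by (intro add_mono mult_left_mono integral_tail_variance_le) auto
    also have "\<dots> \<le> C / sqrt n + 2 * (1 / sqrt n)"
      using n by (intro add_left_mono mult_left_mono divide_left_mono) auto
    finally show ?thesis by (simp add: add_divide_distrib)
  qed
  show thesis
  proof (rule that[of "C + 2"])
    fix n :: nat and b :: ereal assume n: "n \<ge> 1"
    show "(\<integral>s. crossing {x. ereal (x \<bullet> t) \<le> b} s \<partial>conv_power F n) \<le> (C + 2) / sqrt n"
      using real_bound[OF n] C(1) by (cases b) (auto simp: crossing_def)
  qed (use C in simp)
qed

end

section \<open>Polyhedra with fixed normals\<close>

lemma degenerate_projection_law_iff:
  assumes "sets F = sets borel"
  shows "degenerate (projection_law F t) \<longleftrightarrow> (\<exists>a. AE x in F. x \<bullet> t = a)"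
proof -
  have [measurable_cong]: "sets F = sets borel" by fact
  show ?thesis by (simp add: degenerate_def projection_law_def AE_distr_iff)
qed

lemma projection_law_eq_return_0_imp_AE:
  assumes "sets F = sets borel" "projection_law F t = return borel 0"
  shows "AE x in F. x \<bullet> t = 0"
proof -
  have [measurable_cong]: "sets F = sets borel" by fact
  have "AE y in projection_law F t. y = 0" unfolding assms(2) by (subst AE_return) auto
  then show ?thesis unfolding projection_law_def by (subst (asm) AE_distr_iff) measurable
qed

theorem theorem6:
  fixes F :: "(real ^ 'd) measure" and m :: nat and t :: "nat \<Rightarrow> real ^ 'd"
  assumes "prob_space F" and "sets F = sets borel"
    and "m \<ge> 1"
    and "\<And>j. j \<in> {1..m} \<Longrightarrow>
      \<not> degenerate (projection_law F (t j)) \<or> projection_law F (t j) = return borel 0"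
  shows "\<exists>c::real. c > 0 \<and> (\<forall>n::nat. n \<ge> 1 \<longrightarrow> (\<forall>X \<in> polyhedra m t.
    \<bar>measure (conv_power F n) X - measure (conv_power F (n + 1)) X\<bar> \<le> c * real n powr (- 1 / 2)))"
proof -
  interpret prob_space F by fact
  interpret F: borel_prob_space F by unfold_locales fact
  define halfspace where "halfspace u b = {x. ereal (x \<bullet> u) \<le> b}" for u :: "real ^ 'd" and b
  have [measurable]: "halfspace u b \<in> sets borel" for u b unfolding halfspace_def by measurable
  have mem_halfspace: "x \<in> halfspace u b \<longleftrightarrow> ereal (x \<bullet> u) \<le> b" for x u b
    by (simp add: halfspace_def)
  have mem_halfspace_minus: "x \<in> halfspace (- u) (- b) \<longleftrightarrow> b \<le> ereal (x \<bullet> u)" for x u b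
    using ereal_minus_le_minus[of "ereal (x \<bullet> u)" b] by (simp add: halfspace_def)
  \<comment> \<open>\<open>C / sqrt n\<close> bounds the crossing probability after \<open>n\<close> steps for all half-spaces with normal
    \<open>u\<close> at once.\<close>
  define good where "good u C \<longleftrightarrow> C \<ge> 0 \<and> (\<forall>n b. n \<ge> 1 \<longrightarrow>
      (\<integral>s. F.crossing (halfspace u b) s \<partial>conv_power F n) \<le> C / sqrt n)" for u C
  have good_ex: "\<exists>C. good u C" if u: "\<not> (\<exists>a. AE x in F. x \<bullet> u = a) \<or> (AE x in F. x \<bullet> u = 0)" for u
    using F.integral_crossing_halfspace_le[OF u] unfolding good_def halfspace_def by metis
  have "\<exists>C. good (t j) C" and "\<exists>C. good (- t j) C" if "j \<in> {1..m}" for j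
  proof -
    have *: "\<not> (\<exists>a. AE x in F. x \<bullet> t j = a) \<or> (AE x in F. x \<bullet> t j = 0)"
      using assms(4)[OF that] projection_law_eq_return_0_imp_AE[OF assms(2)]
        degenerate_projection_law_iff[OF assms(2)] by blast
    then show "\<exists>C. good (t j) C" by (rule good_ex)
    have neg: "AE x in F. x \<bullet> t j = - a" if "AE x in F. x \<bullet> (- t j) = a" for a
      using that by eventually_elim auto
    show "\<exists>C. good (- t j) C"
    proof (rule good_ex)
      show "\<not> (\<exists>a. AE x in F. x \<bullet> (- t j) = a) \<or> (AE x in F. x \<bullet> (- t j) = 0)"
        using *
      proof (elim disj_forward)
        assume "\<not> (\<exists>a. AE x in F. x \<bullet> t j = a)"
        then show "\<not> (\<exists>a. AE x in F. x \<bullet> (- t j) = a)" using neg by metis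
      next
        assume "AE x in F. x \<bullet> t j = 0"
        then show "AE x in F. x \<bullet> (- t j) = 0" by eventually_elim simp
      qed
    qed
  qed
  then obtain C C' where C: "\<And>j. j \<in> {1..m} \<Longrightarrow> good (t j) (C j)"
      and C': "\<And>j. j \<in> {1..m} \<Longrightarrow> good (- t j) (C' j)"
    by metis
  define c where "c = (\<Sum>j\<in>{1..m}. C j + C' j) + 1"
  have "c > 0" using C C' by (auto simp: c_def good_def intro!: add_nonneg_pos sum_nonneg)
  moreover have "\<bar>measure (conv_power F n) X - measure (conv_power F (n + 1)) X\<bar> \<le>
      c * real n powr (- 1 / 2)" if n: "n \<ge> 1" and X: "X \<in> polyhedra m t" for n X
  proof -
    obtain a b where X_eq: "X = {x. \<forall>j\<in>{1..m}. a j \<le> ereal (x \<bullet> t j) \<and> ereal (x \<bullet> t j) \<le> b j}"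
      using X by (auto simp: polyhedra_def)
    \<comment> \<open>Lower constraints \<open>a j \<le> \<langle>x, t j\<rangle>\<close> become half-spaces with normal \<open>- t j\<close>.\<close>
    define H where "H = (\<lambda>(j, up). if up then halfspace (t j) (b j) else halfspace (- t j) (- a j))"
    have [measurable]: "H i \<in> sets borel" for i by (cases i) (simp add: H_def)
    define I where "I = {1..m} \<times> {True, False}"
    have X_INT: "X = (\<Inter>i\<in>I. H i)"
    proof (rule set_eqI)
      fix x
      have "x \<in> (\<Inter>i\<in>I. H i) \<longleftrightarrow> (\<forall>j\<in>{1..m}. \<forall>up\<in>{True, False}. x \<in> H (j, up))"
        unfolding I_def INT_iff by (rule split_paired_Ball_Sigma)
      also have "\<dots> \<longleftrightarrow>
          (\<forall>j\<in>{1..m}. x \<in> halfspace (t j) (b j) \<and> x \<in> halfspace (- t j) (- a j))"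
        by (simp add: H_def ex_bool_eq)
      finally have "x \<in> (\<Inter>i\<in>I. H i) \<longleftrightarrow>
          (\<forall>j\<in>{1..m}. x \<in> halfspace (t j) (b j) \<and> x \<in> halfspace (- t j) (- a j))" .
      then show "x \<in> X \<longleftrightarrow> x \<in> (\<Inter>i\<in>I. H i)"
        unfolding mem_halfspace_minus unfolding mem_halfspace X_eq by blast
    qed
    have INT_sets: "(\<Inter>i\<in>I. H i) \<in> sets borel"
      unfolding X_INT[symmetric] X_eq by measurable
    have "\<bar>measure (conv_power F n) X - measure (conv_power F (n + 1)) X\<bar> \<le>
        (\<integral>s. F.crossing (\<Inter>i\<in>I. H i) s \<partial>conv_power F n)"
      unfolding X_INT Suc_eq_plus1[symmetric]
      by (rule F.conv_power_diff_le_crossing[OF INT_sets])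
    also have "\<dots> \<le> (\<integral>s. (\<Sum>i\<in>I. F.crossing (H i) s) \<partial>conv_power F n)"
      by (intro integral_mono F.crossing_INT_le F.integrable_crossing
        Bochner_Integration.integrable_sum INT_sets) (auto simp: I_def)
    also have "\<dots> = (\<Sum>i\<in>I. \<integral>s. F.crossing (H i) s \<partial>conv_power F n)"
      by (intro Bochner_Integration.integral_sum F.integrable_crossing) auto
    also have "\<dots> = (\<Sum>j\<in>{1..m}. (\<integral>s. F.crossing (halfspace (t j) (b j)) s \<partial>conv_power F n) +
        (\<integral>s. F.crossing (halfspace (- t j) (- a j)) s \<partial>conv_power F n))"
      unfolding I_def sum.cartesian_product' by (simp add: H_def)
    also have "\<dots> \<le> (\<Sum>j\<in>{1..m}. C j / sqrt n + C' j / sqrt n)"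
      using C C' n by (intro sum_mono add_mono) (auto simp: good_def)
    also have "\<dots> = (c - 1) / sqrt n"
      by (simp add: c_def sum_divide_distrib add_divide_distrib)
    also have "\<dots> \<le> c / sqrt n" by (intro divide_right_mono) auto
    also have "\<dots> = c * real n powr (- 1 / 2)"
      using n by (simp add: powr_minus_divide powr_half_sqrt)
    finally show ?thesis .
  qed
  ultimately show ?thesis by blast
qed

end
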